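(* For any $\delta>0$ there exist $N\in\mathbb N$, a weight $w:T^2_N\to\{0,1\}$, and a (finite, nonnegative) measure $\mu$ on $\partial T^2_N$ such that $$\sum_{Q\in T_N^2,\;Q\subset E}\mu(Q)^2\,w_Q\le\delta\,\mu(E)\qquad\text{for every }E\subset\partial T_N^2,$$ but there exists a set $F\subset[0,1]^2$ (a union of elements of $\partial T_N^2$) such that $$\sum_{Q\in T_N^2}\mu(Q\cap F)^2\,w_Q>\mu(F).$$
   Context: $T^2_N$ is the set of all dyadic rectangles contained in $[0,1]^2$ (products of two dyadic intervals) with both side lengths at least $2^{-N}$, ordered by inclusion. $\partial T^2_N$ is the set of its minimal elements, i.e. the dyadic squares of size $2^{-N}\times2^{-N}$. A measure $\mu$ on $\partial T^2_N$ is a function $\mu:\partial T_N^2\to[0,\infty)$. Sets $E\subset\partial T^2_N$ are identified with the union of their elements (and rectangles $Q\in T_N^2$ with the set of minimal squares they contain): $\mu(E)=\sum_{\omega\in E}\mu(\omega)$, $\mu(Q)=\sum_{\omega\subset Q}\mu(\omega)$, $\mu(Q\cap E)=\sum_{\omega\in E,\,\omega\subset Q}\mu(\omega)$, and $Q\subset E$ means that every $\omega\in\partial T_N^2$ with $\omega\subset Q$ belongs to $E$. $w_Q$ denotes $w(Q)$. *)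

theory Defs
  imports Complex_Main "HOL-Library.FuncSet"
begin

definition dyadic_interval :: "nat \<Rightarrow> int \<Rightarrow> real set" where
  "dyadic_interval n k = {of_int k / 2 ^ n .. (of_int k + 1) / 2 ^ n}"

text \<open>A dyadic interval contained in the unit interval has length \<open>1 / 2 ^ n\<close> with \<open>n\<close> a natural
  number, and that length is at least \<open>1 / 2 ^ N\<close> exactly when \<open>n \<le> N\<close>.\<close>

definition dyadic_rects :: "nat \<Rightarrow> (real \<times> real) set set" where
  "dyadic_rects N =
     {dyadic_interval m j \<times> dyadic_interval n k | m n j k.
        m \<le> N \<and> n \<le> N \<and> dyadic_interval m j \<times> dyadic_interval n k \<subseteq> {0..1} \<times> {0..1}}"

definition min_squares :: "nat \<Rightarrow> (real \<times> real) set set" where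
  "min_squares N = {\<omega> \<in> dyadic_rects N. \<forall>Q \<in> dyadic_rects N. Q \<subseteq> \<omega> \<longrightarrow> Q = \<omega>}"

text \<open>The set of minimal squares with which the rectangle \<open>Q\<close> is identified.\<close>

definition cells :: "nat \<Rightarrow> (real \<times> real) set \<Rightarrow> (real \<times> real) set set" where
  "cells N Q = {\<omega> \<in> min_squares N. \<omega> \<subseteq> Q}"

lemma dyadic_interval_nonempty: "dyadic_interval n k \<noteq> {}"
  by (simp add: dyadic_interval_def divide_right_mono)

lemma dyadic_interval_subset_unit:
  "dyadic_interval n k \<subseteq> {0..1} \<longleftrightarrow> 0 \<le> k \<and> k < 2 ^ n"
proof -
  have "dyadic_interval n k \<subseteq> {0..1} \<longleftrightarrow> 0 \<le> real_of_int k / 2 ^ n \<and> (real_of_int k + 1) / 2 ^ n \<le> 1"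
    by (simp add: dyadic_interval_def divide_right_mono)
  also have "\<dots> \<longleftrightarrow> 0 \<le> real_of_int k \<and> real_of_int k + 1 \<le> 2 ^ n"
    by (simp add: pos_le_divide_eq pos_divide_le_eq)
  also have "\<dots> \<longleftrightarrow> 0 \<le> real_of_int k \<and> real_of_int (k + 1) \<le> real_of_int (2 ^ n)"
    by simp
  also have "\<dots> \<longleftrightarrow> 0 \<le> k \<and> k < 2 ^ n"
    by (simp only: of_int_le_iff) auto
  finally show ?thesis .
qed

lemma dyadic_interval_eq_iff:
  "dyadic_interval m j = dyadic_interval n k \<longleftrightarrow> m = n \<and> j = k"
proof
  assume eq: "dyadic_interval m j = dyadic_interval n k"
  have *: "real_of_int j / 2 ^ m = real_of_int k / 2 ^ n"
    "(real_of_int j + 1) / 2 ^ m = (real_of_int k + 1) / 2 ^ n"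
    using eq dyadic_interval_nonempty[of m j] dyadic_interval_nonempty[of n k]
    unfolding dyadic_interval_def by (simp_all add: Icc_eq_Icc)
  then have "1 / (2::real) ^ m = 1 / 2 ^ n"
    by (simp add: add_divide_distrib)
  then have "m = n" by simp
  with * show "m = n \<and> j = k" by simp
qed simp

lemma dyadic_interval_left_half: "dyadic_interval (Suc n) (2 * k) \<subseteq> dyadic_interval n k"
proof -
  have "(real_of_int (2 * k) + 1) / 2 ^ Suc n \<le> (real_of_int k + 1) / 2 ^ n"
    by (simp add: field_simps)
  then show ?thesis
    by (auto simp: dyadic_interval_def)
qed

lemma dyadic_interval_subset_imp_eq:
  assumes "dyadic_interval m j \<subseteq> dyadic_interval n k" and "m \<le> n"
  shows "dyadic_interval m j = dyadic_interval n k"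
proof -
  have le: "real_of_int k / 2 ^ n \<le> real_of_int j / 2 ^ m"
    "(real_of_int j + 1) / 2 ^ m \<le> (real_of_int k + 1) / 2 ^ n"
    using assms(1) dyadic_interval_nonempty[of m j]
    unfolding dyadic_interval_def by (simp_all add: atLeastatMost_subset_iff)
  have "1 / (2::real) ^ n \<le> 1 / 2 ^ m"
    using assms(2) by (simp add: frac_le power_increasing)
  with le have "real_of_int k / 2 ^ n = real_of_int j / 2 ^ m"
    "(real_of_int j + 1) / 2 ^ m = (real_of_int k + 1) / 2 ^ n"
    unfolding add_divide_distrib by linarith+
  then show ?thesis
    by (simp add: dyadic_interval_def)
qed

lemma dyadic_rects_alt:
  "dyadic_rects N =
     {dyadic_interval m j \<times> dyadic_interval n k | m n j k.
        m \<le> N \<and> n \<le> N \<and> j \<in> {0..<2 ^ m} \<and> k \<in> {0..<2 ^ n}}"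
  unfolding dyadic_rects_def times_subset_iff dyadic_interval_subset_unit
  by (simp add: dyadic_interval_nonempty)

lemma finite_dyadic_rects: "finite (dyadic_rects N)"
proof -
  have "dyadic_rects N \<subseteq> (\<lambda>(m, n, j, k). dyadic_interval m j \<times> dyadic_interval n k) `
      ({..N} \<times> {..N} \<times> {0..<2 ^ N} \<times> {0..<2 ^ N})"
  proof
    fix Q assume "Q \<in> dyadic_rects N"
    then obtain m n j k where *: "Q = dyadic_interval m j \<times> dyadic_interval n k"
      "m \<le> N" "n \<le> N" "0 \<le> j" "0 \<le> k" "j < 2 ^ m" "k < 2 ^ n"
      unfolding dyadic_rects_alt by auto
    have "(2::int) ^ m \<le> 2 ^ N" "(2::int) ^ n \<le> 2 ^ N"
      using * by (simp_all add: power_increasing)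
    with *(6,7) have "j < 2 ^ N" "k < 2 ^ N" by linarith+
    with * show "Q \<in> (\<lambda>(m, n, j, k). dyadic_interval m j \<times> dyadic_interval n k) `
        ({..N} \<times> {..N} \<times> {0..<2 ^ N} \<times> {0..<2 ^ N})"
      by (intro image_eqI[where x = "(m, n, j, k)"]) auto
  qed
  then show ?thesis
    by (rule finite_subset) auto
qed

lemma min_squares_eq:
  "min_squares N =
     {dyadic_interval N j \<times> dyadic_interval N k | j k. j \<in> {0..<2 ^ N} \<and> k \<in> {0..<2 ^ N}}"
  (is "_ = ?S")
proof (intro equalityI subsetI)
  fix \<omega> assume "\<omega> \<in> min_squares N"
  then have in_rects: "\<omega> \<in> dyadic_rects N"
    and min: "\<And>Q. Q \<in> dyadic_rects N \<Longrightarrow> Q \<subseteq> \<omega> \<Longrightarrow> Q = \<omega>"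
    by (auto simp: min_squares_def)
  from in_rects obtain m n j k where w: "\<omega> = dyadic_interval m j \<times> dyadic_interval n k"
    and le: "m \<le> N" "n \<le> N" and jk: "j \<in> {0..<2 ^ m}" "k \<in> {0..<2 ^ n}"
    unfolding dyadic_rects_alt by blast
  have "m = N"
  proof (rule ccontr)
    assume "m \<noteq> N"
    with le have "Suc m \<le> N" by simp
    moreover have "2 * j \<in> {0..<2 ^ Suc m}" using jk by simp
    ultimately have "dyadic_interval (Suc m) (2 * j) \<times> dyadic_interval n k \<in> dyadic_rects N"
      using le jk unfolding dyadic_rects_alt by blast
    from min[OF this] have
      "dyadic_interval (Suc m) (2 * j) \<times> dyadic_interval n k = dyadic_interval m j \<times> dyadic_interval n k"
      unfolding w using dyadic_interval_left_half by blast
    then show False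
      by (simp add: times_eq_iff dyadic_interval_nonempty dyadic_interval_eq_iff)
  qed
  moreover have "n = N"
  proof (rule ccontr)
    assume "n \<noteq> N"
    with le have "Suc n \<le> N" by simp
    moreover have "2 * k \<in> {0..<2 ^ Suc n}" using jk by simp
    ultimately have "dyadic_interval m j \<times> dyadic_interval (Suc n) (2 * k) \<in> dyadic_rects N"
      using le jk unfolding dyadic_rects_alt by blast
    from min[OF this] have
      "dyadic_interval m j \<times> dyadic_interval (Suc n) (2 * k) = dyadic_interval m j \<times> dyadic_interval n k"
      unfolding w using dyadic_interval_left_half by blast
    then show False
      by (simp add: times_eq_iff dyadic_interval_nonempty dyadic_interval_eq_iff)
  qed
  ultimately show "\<omega> \<in> ?S" using w jk by blast
next
  fix \<omega> assume "\<omega> \<in> ?S"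
  then obtain j k where w: "\<omega> = dyadic_interval N j \<times> dyadic_interval N k"
    and jk: "j \<in> {0..<2 ^ N}" "k \<in> {0..<2 ^ N}"
    by blast
  have "\<omega> \<in> dyadic_rects N"
    unfolding dyadic_rects_alt using w jk by blast
  moreover have "Q = \<omega>" if Q: "Q \<in> dyadic_rects N" "Q \<subseteq> \<omega>" for Q
  proof -
    from Q(1) obtain m n i l where q: "Q = dyadic_interval m i \<times> dyadic_interval n l"
      and le: "m \<le> N" "n \<le> N"
      unfolding dyadic_rects_alt by blast
    have "dyadic_interval m i \<subseteq> dyadic_interval N j" "dyadic_interval n l \<subseteq> dyadic_interval N k"
      using Q(2) unfolding q w times_subset_iff by (simp_all add: dyadic_interval_nonempty)
    then show ?thesis
      using le dyadic_interval_subset_imp_eq unfolding q w by metis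
  qed
  ultimately show "\<omega> \<in> min_squares N"
    by (auto simp: min_squares_def)
qed

end

theory Submission
  imports Defs
begin

text \<open>The \<open>N + 1\<close> rectangles \<open>[0, 2\<^sup>-\<^sup>a] \<times> [0, 2\<^sup>-\<^sup>(\<^sup>N\<^sup>-\<^sup>a\<^sup>)]\<close> all contain the minimal square at the origin,
  while the minimal square at the upper right corner of each of them lies in no other one.
  Put mass \<open>m = \<delta> / 4\<close> on the origin square and on each corner square, and let \<open>w\<close> select
  exactly these rectangles. Each has \<open>\<mu>(Q)\<^sup>2 = (2m)\<^sup>2 = \<delta>m\<close>, which is paid for by its own corner,
  so the Carleson condition holds. But for \<open>F\<close> the origin square the energy is \<open>(N + 1) m\<^sup>2\<close>,
  which exceeds \<open>\<mu>(F) = m\<close> once \<open>N + 1 > 1 / m\<close>.\<close>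

definition hyp_rect :: "nat \<Rightarrow> nat \<Rightarrow> (real \<times> real) set" where
  "hyp_rect N a = dyadic_interval a 0 \<times> dyadic_interval (N - a) 0"

definition origin_square :: "nat \<Rightarrow> (real \<times> real) set" where
  "origin_square N = dyadic_interval N 0 \<times> dyadic_interval N 0"

text \<open>A side of length \<open>2^-n\<close> splits into \<open>2^(N - n)\<close> intervals of
  length \<open>2^-N\<close>, the last having index \<open>2^(N - n) - 1\<close>. With
  \<open>n = a\<close> and \<open>n = N - a\<close> this gives the upper right cell of
  \<open>hyp_rect N a\<close>.\<close>

definition corner_square :: "nat \<Rightarrow> nat \<Rightarrow> (real \<times> real) set" where
  "corner_square N a = dyadic_interval N (2 ^ (N - a) - 1) \<times> dyadic_interval N (2 ^ a - 1)"

text \<open>As \<open>0 \<le> j\<close>, only the right endpoints matter, and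
  \<open>(j + 1) / 2^N \<le> 1 / 2^n\<close> becomes an integer inequality after scaling by
  \<open>2^N\<close>.\<close>

lemma dyadic_interval_subset_initial:
  assumes "n \<le> N" "0 \<le> j"
  shows "dyadic_interval N j \<subseteq> dyadic_interval n 0 \<longleftrightarrow> j < 2 ^ (N - n)"
proof -
  have pow: "(2::real) ^ N = 2 ^ n * 2 ^ (N - n)"
    using assms(1) by (simp flip: power_add)
  have "dyadic_interval N j \<subseteq> dyadic_interval n 0 \<longleftrightarrow> (real_of_int j + 1) / 2 ^ N \<le> 1 / 2 ^ n"
    using assms(2) by (auto simp: dyadic_interval_def atLeastatMost_subset_iff divide_right_mono)
  also have "\<dots> \<longleftrightarrow> real_of_int j + 1 \<le> 2 ^ (N - n)"
    unfolding pow by (simp add: pos_divide_le_eq)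
  also have "\<dots> \<longleftrightarrow> real_of_int (j + 1) \<le> real_of_int (2 ^ (N - n))"
    by simp
  also have "\<dots> \<longleftrightarrow> j < 2 ^ (N - n)"
    by (simp only: of_int_le_iff) auto
  finally show ?thesis .
qed

lemma hyp_rect_in_dyadic_rects: "a \<le> N \<Longrightarrow> hyp_rect N a \<in> dyadic_rects N"
  unfolding dyadic_rects_alt hyp_rect_def
  by (rule CollectI, rule exI[of _ a], rule exI[of _ "N - a"], rule exI[of _ 0], rule exI[of _ 0]) simp

lemma inj_on_hyp_rect: "inj_on (hyp_rect N) {..N}"
  by (auto simp: inj_on_def hyp_rect_def times_eq_iff dyadic_interval_nonempty dyadic_interval_eq_iff)

lemma origin_square_in_cells:
  assumes "a \<le> N"
  shows "origin_square N \<in> cells N (hyp_rect N a)"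
proof -
  have "origin_square N \<in> min_squares N"
    unfolding min_squares_eq origin_square_def
    by (rule CollectI, rule exI[of _ 0], rule exI[of _ 0]) simp
  moreover have "origin_square N \<subseteq> hyp_rect N a"
    using assms by (simp add: origin_square_def hyp_rect_def times_subset_iff dyadic_interval_subset_initial)
  ultimately show ?thesis
    by (simp add: cells_def)
qed

text \<open>The side lengths trade off: fitting horizontally forces \<open>b \<le> a\<close>,
  fitting vertically forces \<open>a \<le> b\<close>.\<close>

lemma corner_square_in_cells_iff:
  assumes "a \<le> N" "b \<le> N"
  shows "corner_square N a \<in> cells N (hyp_rect N b) \<longleftrightarrow> a = b"
proof -
  have "corner_square N a \<in> min_squares N"
  proof -
    have "(2::int) ^ (N - a) \<le> 2 ^ N" "(2::int) ^ a \<le> 2 ^ N"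
      using assms by (simp_all add: power_increasing)
    moreover have "(1::int) \<le> 2 ^ (N - a)" "(1::int) \<le> 2 ^ a"
      by simp_all
    ultimately have "(2::int) ^ (N - a) - 1 \<in> {0..<2 ^ N}" "(2::int) ^ a - 1 \<in> {0..<2 ^ N}"
      unfolding atLeastLessThan_iff by linarith+
    then show ?thesis
      unfolding min_squares_eq corner_square_def by blast
  qed
  moreover have "corner_square N a \<subseteq> hyp_rect N b \<longleftrightarrow> N - a \<le> N - b \<and> a \<le> b"
  proof -
    \<comment> \<open>The \<open>- 1\<close> in the corner indices turns the strict index bound into
      a weak comparison of exponents.\<close>
    have "(2::int) ^ k - 1 < 2 ^ l \<longleftrightarrow> k \<le> l" for k l :: nat
    proof -
      have "(2::int) ^ k - 1 < 2 ^ l \<longleftrightarrow> (2::int) ^ k \<le> 2 ^ l" by linarith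
      then show ?thesis by simp
    qed
    then show ?thesis
      using assms unfolding corner_square_def hyp_rect_def
      by (simp add: times_subset_iff dyadic_interval_nonempty dyadic_interval_subset_initial)
  qed
  ultimately show ?thesis
    using assms by (auto simp: cells_def)
qed

lemma inj_on_corner_square: "inj_on (corner_square N) {..N}"
  by (rule inj_onI) (metis atMost_iff corner_square_in_cells_iff)

lemma origin_neq_corner:
  assumes "N \<ge> 1" "a \<le> N"
  shows "origin_square N \<noteq> corner_square N a"
proof
  \<comment> \<open>A second rectangle exists because \<open>N \<ge> 1\<close>; it contains the
    origin square but not this corner. For \<open>N = 0\<close> the two squares coincide.\<close>
  obtain b where "b \<le> N" "b \<noteq> a"
    using assms by (metis not_one_le_zero order_refl zero_le)
  moreover assume "origin_square N = corner_square N a"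
  ultimately show False
    using origin_square_in_cells[of b N] corner_square_in_cells_iff[of a N b] assms by simp
qed

lemma finite_min_squares: "finite (min_squares N)"
  using finite_dyadic_rects[of N] by (simp add: min_squares_def)

theorem proposition11p1:
  fixes \<delta> :: real
  assumes "\<delta> > 0"
  shows "\<exists>(N::nat) (w :: (real \<times> real) set \<Rightarrow> real) (\<mu> :: (real \<times> real) set \<Rightarrow> real).
    w \<in> dyadic_rects N \<rightarrow> {0, 1} \<and>
    \<mu> \<in> min_squares N \<rightarrow> {0..} \<and>
    (\<forall>E \<subseteq> min_squares N.
      (\<Sum>Q | Q \<in> dyadic_rects N \<and> cells N Q \<subseteq> E. (sum \<mu> (cells N Q))\<^sup>2 * w Q) \<le> \<delta> * sum \<mu> E) \<and>
    (\<exists>F \<subseteq> min_squares N.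
      (\<Sum>Q \<in> dyadic_rects N. (sum \<mu> (cells N Q \<inter> F))\<^sup>2 * w Q) > sum \<mu> F)"
proof -
  define m where "m = \<delta> / 4"
  have "m > 0" using assms by (simp add: m_def)
  obtain N :: nat where "1 / m < real N" using reals_Archimedean2 by blast
  \<comment> \<open>Positivity of \<open>1 / m\<close> already excludes
    \<open>N = 0\<close>.\<close>
  then have N: "real (Suc N) * m > 1" and "N \<ge> 1"
    using \<open>m > 0\<close> by (auto simp: field_simps Suc_le_eq intro!: gr0I)
  define P where "P = insert (origin_square N) (corner_square N ` {..N})"
  define \<mu> where "\<mu> = (\<lambda>x. if x \<in> P then m else 0)"
  define w :: "(real \<times> real) set \<Rightarrow> real" where
    "w = (\<lambda>Q. if Q \<in> hyp_rect N ` {..N} then 1 else 0)"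
  have fin: "finite A" if "A \<subseteq> min_squares N" for A
    using that finite_min_squares finite_subset by blast
  have sum_\<mu>: "sum \<mu> A = m * card (A \<inter> P)" if "A \<subseteq> min_squares N" for A
    using fin[OF that] by (simp add: \<mu>_def sum.If_cases)
  \<comment> \<open>\<open>w\<close> vanishes off the selected rectangles, so sums over rectangles
    become sums over \<open>a\<close>. The predicate \<open>R\<close> lets this serve both the
    Carleson sum and the unrestricted energy.\<close>
  have sum_w: "(\<Sum>Q | Q \<in> dyadic_rects N \<and> R Q. f Q * w Q) = (\<Sum>a | a \<le> N \<and> R (hyp_rect N a). f (hyp_rect N a))"
    for f :: "_ \<Rightarrow> real" and R
  proof -
    have "(\<Sum>Q | Q \<in> dyadic_rects N \<and> R Q. f Q * w Q) = sum f (hyp_rect N ` {a. a \<le> N \<and> R (hyp_rect N a)})"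
      using finite_dyadic_rects[of N] hyp_rect_in_dyadic_rects
      by (intro sum.mono_neutral_cong_right) (auto simp: w_def)
    also have "\<dots> = (\<Sum>a | a \<le> N \<and> R (hyp_rect N a). f (hyp_rect N a))"
      by (rule sum.reindex_cong[OF inj_on_subset[OF inj_on_hyp_rect[of N]]]) auto
    finally show ?thesis .
  qed
  have sub: "cells N Q \<subseteq> min_squares N" for Q
    by (auto simp: cells_def)
  have mass: "sum \<mu> (cells N (hyp_rect N a)) = 2 * m" if "a \<le> N" for a
  proof -
    have "cells N (hyp_rect N a) \<inter> P = {origin_square N, corner_square N a}"
      using that by (auto simp: P_def origin_square_in_cells corner_square_in_cells_iff)
    then show ?thesis
      using origin_neq_corner[OF \<open>N \<ge> 1\<close> that] by (simp add: sum_\<mu>[OF sub])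
  qed
  have carleson: "(\<Sum>Q | Q \<in> dyadic_rects N \<and> cells N Q \<subseteq> E. (sum \<mu> (cells N Q))\<^sup>2 * w Q) \<le> \<delta> * sum \<mu> E"
    if E: "E \<subseteq> min_squares N" for E
  proof -
    define S where "S = {a. a \<le> N \<and> cells N (hyp_rect N a) \<subseteq> E}"
    \<comment> \<open>Each rectangle inside \<open>E\<close> brings its own corner into
      \<open>E\<close>, and distinct rectangles have distinct corners, so the charged squares of
      \<open>E\<close> number at least \<open>card S\<close>.\<close>
    have "corner_square N ` S \<subseteq> E \<inter> P"
      using corner_square_in_cells_iff by (fastforce simp: S_def P_def)
    then have "card (corner_square N ` S) \<le> card (E \<inter> P)"
      using fin[OF E] by (intro card_mono) auto
    moreover have "card (corner_square N ` S) = card S"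
      by (rule card_image, rule inj_on_subset[OF inj_on_corner_square[of N]]) (auto simp: S_def)
    ultimately have "card S \<le> card (E \<inter> P)" by simp
    have "(\<Sum>Q | Q \<in> dyadic_rects N \<and> cells N Q \<subseteq> E. (sum \<mu> (cells N Q))\<^sup>2 * w Q) = (\<Sum>a\<in>S. (2 * m)\<^sup>2)"
      unfolding sum_w by (auto simp: S_def mass intro!: sum.cong)
    also have "\<dots> = \<delta> * (m * card S)"
      by (simp add: m_def power2_eq_square)
    also have "\<dots> \<le> \<delta> * (m * card (E \<inter> P))"
      using \<open>card S \<le> _\<close> \<open>m > 0\<close> assms by (intro mult_left_mono) auto
    finally show ?thesis by (simp add: sum_\<mu>[OF E])
  qed
  have "sum \<mu> {origin_square N} < (\<Sum>Q \<in> dyadic_rects N. (sum \<mu> (cells N Q \<inter> {origin_square N}))\<^sup>2 * w Q)"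
  proof -
    have "(\<Sum>Q \<in> dyadic_rects N. (sum \<mu> (cells N Q \<inter> {origin_square N}))\<^sup>2 * w Q)
        = (\<Sum>a\<le>N. (sum \<mu> (cells N (hyp_rect N a) \<inter> {origin_square N}))\<^sup>2)"
      using sum_w[where R = "\<lambda>_. True"] by (simp add: atMost_def)
    \<comment> \<open>Every selected rectangle meets \<open>F\<close> in exactly the origin square,
      of mass \<open>m\<close>.\<close>
    also have "\<dots> = (\<Sum>a\<le>N. m\<^sup>2)"
      by (intro sum.cong) (simp_all add: origin_square_in_cells \<mu>_def P_def)
    also have "\<dots> = m * (real (Suc N) * m)"
      by (simp add: power2_eq_square)
    also have "\<dots> > m * 1"
      using N \<open>m > 0\<close> by (rule mult_strict_left_mono)
    finally show ?thesis by (simp add: \<mu>_def P_def)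
  qed
  moreover have "{origin_square N} \<subseteq> min_squares N"
    using origin_square_in_cells[of 0 N] sub by blast
  ultimately have "\<exists>F \<subseteq> min_squares N. sum \<mu> F < (\<Sum>Q \<in> dyadic_rects N. (sum \<mu> (cells N Q \<inter> F))\<^sup>2 * w Q)"
    by blast
  moreover have "w \<in> dyadic_rects N \<rightarrow> {0, 1}" "\<mu> \<in> min_squares N \<rightarrow> {0..}"
    using \<open>m > 0\<close> by (auto simp: w_def \<mu>_def)
  ultimately show ?thesis
    using carleson by blast
qed

end
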